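(* Let $n\ge 1$, let $V=\mathbb{C}^n$, let $W\subset\mathrm{GL}(V)$ be a finite complex reflection group, let $f_W$ be its fundamental skew invariant, and let $D=\deg f_W$. Let $d$ be a positive integer, let $w\in W$, and let $L\in V$ be a regular vector that is an eigenvector of $w$ with eigenvalue $e^{2\pi i/d}$. Let $C_w\subset W$ be the cyclic subgroup generated by $w$, and let $W/C_w$ denote the set of left cosets, with one representative $\sigma$ chosen (arbitrarily) in each coset. Then there is a nonzero scalar $C\in\mathbb{C}$ such that $$f_W=C\sum_{\sigma\in W/C_w}(\det\sigma)\,(\sigma\cdot L)^D .$$
   Context: A non-identity element $t\in\mathrm{GL}(V)$ of finite order is a pseudo-reflection if it fixes a hyperplane $H_t\subset V$ pointwise, so that it has eigenvalue $1$ with multiplicity $n-1$ and exactly one further eigenvalue, which is $\neq 1$ (the exceptional eigenvalue). A complex reflection group is a finite subgroup $W\subset \mathrm{GL}(V)$ generated by pseudo-reflections. The action of $W$ is not assumed to be essential (that is, $W$ may fix nonzero vectors). Let $S=\mathrm{Sym}(V)$, identified with $\mathbb{C}[x_1,\dots,x_n]$ by choosing a basis $x_1,\dots,x_n$ of $V$, with the induced action of $W$; vectors of $V$ are regarded as linear forms in $S$. For each pseudo-reflection $t\in W$, let $L_t\in V$ be an eigenvector of $t$ for its exceptional eigenvalue. The fundamental skew invariant of $W$ is $f_W=\prod_t L_t\in S$, the product being over all pseudo-reflections $t\in W$ (defined up to a nonzero scalar). Its degree $D$ is the number of pseudo-reflections in $W$. The determinant $\det\sigma$ is that of $\sigma$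 acting on $V$. A vector $v\in V$ is regular if it lies on none of the reflecting hyperplanes $H_t\subset V$ ($t$ a pseudo-reflection in $W$). *)

theory Defs
  imports
    "HOL-Analysis.Analysis"
    "HOL-Algebra.Generated_Groups"
    "HOL-Algebra.Left_Coset"
    "HOL-Library.Poly_Mapping"
begin

definition GL :: "(complex^'n^'n) monoid" where
  "GL = \<lparr>carrier = {A. invertible A}, mult = (**), one = mat 1\<rparr>"

lemma group_GL: "group (GL :: (complex^'n^'n) monoid)"
proof (rule groupI)
  fix A :: "complex^'n^'n"
  assume "A \<in> carrier GL"
  then obtain B where "A ** B = mat 1" "B ** A = mat 1"
    by (auto simp: GL_def invertible_def)
  then show "\<exists>B\<in>carrier GL. B \<otimes>\<^bsub>GL\<^esub> A = \<one>\<^bsub>GL\<^esub>"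
    by (auto simp: GL_def invertible_def)
next
  show "\<one>\<^bsub>GL\<^esub> \<in> carrier (GL :: (complex^'n^'n) monoid)"
    by (auto simp: GL_def invertible_def)
qed (auto simp: GL_def invertible_mult matrix_mul_assoc)


subsection \<open>Complex reflection groups\<close>

text \<open>The complex dimension is \<^const>\<open>vec.dim\<close>; the unqualified \<^const>\<open>dim\<close> is the real one.\<close>

definition hyperplane :: "(complex^'n) set \<Rightarrow> bool" where
  "hyperplane H \<longleftrightarrow> vec.subspace H \<and> vec.dim H + 1 = CARD('n)"

definition fixes_hyperplane :: "complex^'n^'n \<Rightarrow> (complex^'n) set \<Rightarrow> bool" where
  "fixes_hyperplane t H \<longleftrightarrow> hyperplane H \<and> (\<forall>v\<in>H. t *v v = v)"

definition pseudo_reflection :: "complex^'n^'n \<Rightarrow> bool" where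
  "pseudo_reflection t \<longleftrightarrow>
     t \<in> carrier GL \<and> t \<noteq> \<one>\<^bsub>GL\<^esub> \<and>
     (\<exists>k::nat. k > 0 \<and> t [^]\<^bsub>GL\<^esub> k = \<one>\<^bsub>GL\<^esub>) \<and>
     (\<exists>H. fixes_hyperplane t H)"

definition pseudo_reflections :: "(complex^'n^'n) set \<Rightarrow> (complex^'n^'n) set" where
  "pseudo_reflections W = {t \<in> W. pseudo_reflection t}"

definition complex_reflection_group :: "(complex^'n^'n) set \<Rightarrow> bool" where
  "complex_reflection_group W \<longleftrightarrow>
     subgroup W GL \<and> finite W \<and> generate GL (pseudo_reflections W) = W"

definition eigenvector :: "complex^'n^'n \<Rightarrow> complex \<Rightarrow> complex^'n \<Rightarrow> bool" where
  "eigenvector A c v \<longleftrightarrow> v \<noteq> 0 \<and> A *v v = c *s v"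

text \<open>As a non-identity element, a pseudo-reflection \<open>t\<close> fixes exactly one hyperplane, so that
  \<open>H\<close> ranges over the reflecting hyperplanes \<open>H\<^sub>t\<close> only.\<close>

definition regular_vector :: "(complex^'n^'n) set \<Rightarrow> complex^'n \<Rightarrow> bool" where
  "regular_vector W v \<longleftrightarrow>
     (\<forall>t\<in>pseudo_reflections W. \<forall>H. fixes_hyperplane t H \<longrightarrow> v \<notin> H)"


subsection \<open>The symmetric algebra\<close>

text \<open>\<open>Sym(\<complex>\<^sup>n)\<close> as the polynomial ring in variables \<open>x\<^sub>i\<close> indexed by \<open>'n\<close>, where \<open>x\<^sub>i\<close> is the
  \<open>i\<close>-th standard basis vector. A monomial is its exponent vector, and the multiplication
  provided by \<^theory>\<open>HOL-Library.Poly_Mapping\<close> is the usual product of polynomials.\<close>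

type_synonym 'n sym_alg = "('n \<Rightarrow>\<^sub>0 nat) \<Rightarrow>\<^sub>0 complex"

definition scalar :: "complex \<Rightarrow> 'n sym_alg" where
  "scalar c = Poly_Mapping.single 0 c"

definition linear_form :: "complex^'n \<Rightarrow> ('n::finite) sym_alg" where
  "linear_form v = (\<Sum>i\<in>UNIV. scalar (v $ i) * Poly_Mapping.single (Poly_Mapping.single i 1) 1)"

definition total_degree :: "('n::finite) sym_alg \<Rightarrow> nat" where
  "total_degree p =
     Max (insert 0 ((\<lambda>m. \<Sum>i\<in>UNIV. Poly_Mapping.lookup m i) ` Poly_Mapping.keys p))"

text \<open>The fundamental skew invariant depends on the choice of the eigenvectors \<open>L\<^sub>t\<close>, hence
  this is a predicate.\<close>

definition fundamental_skew_invariant :: "(complex^'n^'n) set \<Rightarrow> 'n sym_alg \<Rightarrow> bool" where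
  "fundamental_skew_invariant W f \<longleftrightarrow>
     (\<exists>l. (\<forall>t\<in>pseudo_reflections W. \<exists>c. c \<noteq> 1 \<and> eigenvector t c (l t)) \<and>
          f = (\<Prod>t\<in>pseudo_reflections W. linear_form (l t)))"

end

theory Submission
  imports Defs "HOL-Computational_Algebra.Polynomial"
begin

text \<open>
  Call \<open>l t\<close>, the exceptional eigenvector of a reflection \<open>t\<close>, its root, let \<open>T\<close> be the set of
  reflections and \<open>D\<close> its cardinality. Averaging yields a \<open>W\<close>-invariant Hermitian form \<open>herm\<close>, for
  which reflecting hyperplanes are the orthogonal complements of roots
  (\<open>reflection\<close>). Two facts about the product of the roots carry the proof.

  It is skew: \<open>skew x = (\<Prod>t\<in>T. herm x (l t))\<close> satisfies \<open>det s * skew (s *v x) = skew x\<close> for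
  all \<open>s\<close> in \<open>W\<close> (\<open>skew_semi_invariant\<close>). For \<open>w *v L = \<zeta> *s L\<close> with \<open>L\<close> regular, that is
  \<open>skew L \<noteq> 0\<close>, this gives \<open>det w * \<zeta> ^ D = 1\<close>. So the term \<open>(det s) (s L) ^ D\<close> depends only on the
  coset of \<open>s\<close> modulo \<open>w\<close>, and the sum over coset representatives multiplied by the order of \<open>w\<close> is the
  sum over the whole group.

  It divides skew polynomials. Summing \<open>(det s) (s L) ^ D\<close> over a coset of the pointwise stabilizer
  of a reflecting hyperplane, of order \<open>e\<close>, leaves only terms divisible by the \<open>e - 1\<close>-th power of the
  root (\<open>dvd_twisted_power_sum\<close>, \<open>fixator_power_dvd\<close>), and \<open>e - 1\<close> is the multiplicity of this root in the
  product. To avoid unique factorization in several variables, divisibility is used only on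
  generic lines, where the factors are coprime polynomials in one variable. Since
  both are homogeneous of degree \<open>D\<close>, they are proportional there
  (\<open>skew_power_sum_proportional\<close>); since elements of the symmetric algebra are determined
  by their values at generic points (\<open>evaluate_generic_eq_0\<close>), they are proportional as such.

  It remains to see that the sum over the group is not zero. If it were, polarization
  (\<open>polarization\<close>) would turn the vanishing of \<open>\<Sum>s. (det s) (s L) ^ D\<close> into that of
  \<open>\<Sum>s. det s * skew (s *v L)\<close>, but every term of this sum equals \<open>skew L \<noteq> 0\<close>.
\<close>


section \<open>Evaluating elements of the symmetric algebra\<close>

definition evaluate :: "complex^'n \<Rightarrow> ('n::finite) sym_alg \<Rightarrow> complex" where
  "evaluate y p = (\<Sum>m\<in>Poly_Mapping.keys p.
     Poly_Mapping.lookup p m * (\<Prod>i\<in>UNIV. y $ i ^ Poly_Mapping.lookup m i))"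

text \<open>The bilinear (not Hermitian) pairing, through which a linear form takes its values.\<close>
definition dot :: "complex^'n \<Rightarrow> complex^'n \<Rightarrow> complex" where
  "dot v y = (\<Sum>i\<in>UNIV. v $ i * y $ i)"

lemma dot_scale_left: "dot (c *s v) x = c * dot v x"
  by (simp add: dot_def sum_distrib_left mult.assoc)

lemma dot_add_left: "dot (u + v) x = dot u x + dot v x"
  by (simp add: dot_def sum.distrib distrib_right)

lemma dot_add_scale_right: "dot v (x + c *s y) = dot v x + c * dot v y"
  by (simp add: dot_def sum.distrib sum_distrib_left algebra_simps)

lemma dot_diff_left: "dot (u - v) x = dot u x - dot v x"
  by (simp add: dot_def sum_subtractf left_diff_distrib)

lemma evaluate_superset:
  assumes "finite A" "Poly_Mapping.keys p \<subseteq> A"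
  shows "evaluate y p = (\<Sum>m\<in>A. Poly_Mapping.lookup p m * (\<Prod>i\<in>UNIV. y $ i ^ Poly_Mapping.lookup m i))"
  unfolding evaluate_def
  by (rule sum.mono_neutral_left) (use assms in \<open>auto simp: in_keys_iff\<close>)

lemma evaluate_zero [simp]: "evaluate y 0 = 0"
  by (simp add: evaluate_def)

lemma evaluate_single [simp]:
  "evaluate y (Poly_Mapping.single m c) = c * (\<Prod>i\<in>UNIV. y $ i ^ Poly_Mapping.lookup m i)"
  by (cases "c = 0") (auto simp: evaluate_def)

lemma evaluate_add: "evaluate y (p + q) = evaluate y p + evaluate y q"
proof -
  let ?A = "Poly_Mapping.keys p \<union> Poly_Mapping.keys q"
  have "evaluate y (p + q) = (\<Sum>m\<in>?A. Poly_Mapping.lookup (p + q) m * (\<Prod>i\<in>UNIV. y $ i ^ Poly_Mapping.lookup m i))"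
    by (rule evaluate_superset) (auto simp: Poly_Mapping.keys_add)
  also have "\<dots> = evaluate y p + evaluate y q"
    by (simp add: evaluate_superset[of ?A] lookup_add algebra_simps sum.distrib)
  finally show ?thesis .
qed

lemma evaluate_sum: "evaluate y (\<Sum>x\<in>A. p x) = (\<Sum>x\<in>A. evaluate y (p x))"
  by (induction A rule: infinite_finite_induct) (auto simp: evaluate_add)

lemma sum_monomials: "p = (\<Sum>m\<in>Poly_Mapping.keys p. Poly_Mapping.single m (Poly_Mapping.lookup p m))"
  by (rule poly_mapping_eqI) (auto simp: lookup_sum lookup_single when_def in_keys_iff)

lemma evaluate_mult: "evaluate y (p * q) = evaluate y p * evaluate y q"
proof -
  have single: "evaluate y (Poly_Mapping.single a b * Poly_Mapping.single a' b') =
      evaluate y (Poly_Mapping.single a b) * evaluate y (Poly_Mapping.single a' b')" for a b a' b'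
    by (simp add: mult_single lookup_add power_add prod.distrib)
  have "evaluate y (p * q) = evaluate y
     ((\<Sum>m\<in>Poly_Mapping.keys p. Poly_Mapping.single m (Poly_Mapping.lookup p m)) *
      (\<Sum>m\<in>Poly_Mapping.keys q. Poly_Mapping.single m (Poly_Mapping.lookup q m)))"
    by (simp flip: sum_monomials)
  also have "\<dots> = evaluate y (\<Sum>m\<in>Poly_Mapping.keys p. Poly_Mapping.single m (Poly_Mapping.lookup p m)) *
      evaluate y (\<Sum>m\<in>Poly_Mapping.keys q. Poly_Mapping.single m (Poly_Mapping.lookup q m))"
    by (simp only: sum_product evaluate_sum single)
  finally show ?thesis by (simp flip: sum_monomials)
qed

lemma evaluate_one [simp]: "evaluate y 1 = 1"
  by (simp flip: single_one)

lemma evaluate_scalar [simp]: "evaluate y (scalar c) = c"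
  by (simp add: scalar_def)

lemma evaluate_power: "evaluate y (p ^ k) = evaluate y p ^ k"
  by (induction k) (auto simp: evaluate_mult)

lemma evaluate_prod: "evaluate y (\<Prod>x\<in>A. p x) = (\<Prod>x\<in>A. evaluate y (p x))"
  by (induction A rule: infinite_finite_induct) (auto simp: evaluate_mult)

lemma evaluate_linear_form: "evaluate y (linear_form v) = dot v y"
proof -
  have "(\<Prod>j\<in>UNIV. y $ j ^ Poly_Mapping.lookup (Poly_Mapping.single i 1) j) = y $ i" for i
  proof -
    have "(\<Prod>j\<in>UNIV. y $ j ^ Poly_Mapping.lookup (Poly_Mapping.single i (1::nat)) j) =
        (\<Prod>j\<in>UNIV. if j = i then y $ j else 1)"
      by (rule prod.cong) (auto simp: lookup_single when_def)
    then show ?thesis by simp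
  qed
  then show ?thesis
    by (simp add: linear_form_def dot_def evaluate_sum evaluate_mult)
qed

lemmas evaluate_simps = evaluate_add evaluate_sum evaluate_mult evaluate_power evaluate_prod
  evaluate_linear_form

lemma scalar_mult: "scalar a * scalar b = scalar (a * b)"
  by (simp add: scalar_def mult_single)

lemma scalar_1 [simp]: "scalar 1 = 1"
  by (simp add: scalar_def)

lemma scalar_power: "scalar a ^ k = scalar (a ^ k)"
  by (induction k) (auto simp: scalar_mult)

lemma linear_form_scale: "linear_form (c *s v) = scalar c * linear_form v"
  by (simp add: linear_form_def sum_distrib_left scalar_mult mult.assoc flip: scalar_mult)

definition homogeneous :: "nat \<Rightarrow> ('n::finite) sym_alg \<Rightarrow> bool" where
  "homogeneous k p \<longleftrightarrow> (\<forall>m\<in>Poly_Mapping.keys p. (\<Sum>i\<in>UNIV. Poly_Mapping.lookup m i) = k)"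

lemma homogeneous_mult:
  assumes "homogeneous j p" "homogeneous k q"
  shows "homogeneous (j + k) (p * q)"
  unfolding homogeneous_def
proof
  fix m assume "m \<in> Poly_Mapping.keys (p * q)"
  then obtain a b where "a \<in> Poly_Mapping.keys p" "b \<in> Poly_Mapping.keys q" "m = a + b"
    using Poly_Mapping.keys_mult[of p q] by auto
  then show "(\<Sum>i\<in>UNIV. Poly_Mapping.lookup m i) = j + k"
    using assms by (auto simp: homogeneous_def lookup_add sum.distrib)
qed

lemma homogeneous_linear_form: "homogeneous 1 (linear_form v)"
  unfolding homogeneous_def
proof
  fix m assume "m \<in> Poly_Mapping.keys (linear_form v)"
  then obtain i where "m \<in> Poly_Mapping.keys (scalar (v $ i) * Poly_Mapping.single (Poly_Mapping.single i 1) 1)"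
    using Poly_Mapping.keys_sum[of "\<lambda>i. scalar (v $ i) * Poly_Mapping.single (Poly_Mapping.single i 1) 1" UNIV]
    unfolding linear_form_def by blast
  then have "m = Poly_Mapping.single i 1"
    by (auto simp: scalar_def mult_single split: if_splits)
  then show "(\<Sum>i\<in>UNIV. Poly_Mapping.lookup m i) = 1"
    by (simp add: lookup_single when_def)
qed

lemma homogeneous_prod_linear_forms:
  "homogeneous (card A) (\<Prod>t\<in>A. linear_form (l t))"
proof (induction A rule: infinite_finite_induct)
  case (insert x A)
  then show ?case
    using homogeneous_mult[OF homogeneous_linear_form insert.IH, of "l x"] by simp
qed (auto simp: homogeneous_def)

lemma total_degree_homogeneous:
  assumes "homogeneous k p" "p \<noteq> 0"
  shows "total_degree p = k"
proof -
  have "Poly_Mapping.keys p \<noteq> {}"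
  proof
    assume "Poly_Mapping.keys p = {}"
    then have "p = 0" by (subst sum_monomials) simp
    with assms(2) show False by simp
  qed
  moreover have "(\<lambda>m. \<Sum>i\<in>UNIV. Poly_Mapping.lookup m i) ` Poly_Mapping.keys p =
      (\<lambda>_. k) ` Poly_Mapping.keys p"
    using assms(1) by (intro image_cong) (auto simp: homogeneous_def)
  ultimately have "(\<lambda>m. \<Sum>i\<in>UNIV. Poly_Mapping.lookup m i) ` Poly_Mapping.keys p = {k}"
    by (simp add: image_constant_conv)
  then show ?thesis by (simp add: total_degree_def)
qed

text \<open>The nonroot is taken among the natural numbers because it serves as the base of a
  positional system for exponents.\<close>
lemma nonzero_polys_common_nonroot:
  fixes r :: "'a \<Rightarrow> complex poly"
  assumes "finite A" "\<And>a. a \<in> A \<Longrightarrow> r a \<noteq> 0"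
  shows "\<exists>b::nat. b \<ge> k \<and> (\<forall>a\<in>A. poly (r a) (of_nat b) \<noteq> 0)"
proof -
  let ?R = "\<Prod>a\<in>A. r a"
  have "?R \<noteq> 0" using assms by simp
  then have "finite {z. poly ?R z = 0}" by (rule poly_roots_finite)
  then have "finite ((of_nat :: nat \<Rightarrow> complex) -` {z. poly ?R z = 0})"
    by (rule finite_vimageI) (simp add: inj_on_def)
  then obtain n where n: "\<And>b. poly ?R (of_nat b) = 0 \<Longrightarrow> b \<le> n"
    by (auto simp: finite_nat_set_iff_bounded_le)
  then have "poly ?R (of_nat (max k (Suc n))) \<noteq> 0"
    by (metis max.cobounded2 not_less_eq_eq)
  then have "\<forall>a\<in>A. poly (r a) (of_nat (max k (Suc n))) \<noteq> 0"
    using assms(1) by (simp add: poly_prod)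
  then show ?thesis
    by (intro exI[of _ "max k (Suc n)"]) simp
qed

text \<open>Substituting \<open>x\<^sub>i = s ^ (B ^ idx i)\<close> turns \<open>q\<close> into a polynomial in \<open>s\<close>. For a suitable base
  \<open>B\<close> distinct monomials of \<open>q\<close> become distinct powers of \<open>s\<close>, so no coefficient is lost, and
  none of the forms \<open>u a\<close> vanishes identically along this curve. A polynomial in one variable
  that vanishes off a finite set is zero.\<close>
lemma evaluate_generic_eq_0:
  fixes q :: "('n::finite) sym_alg" and u :: "'a \<Rightarrow> complex^'n"
  assumes "finite A" and "\<And>a. a \<in> A \<Longrightarrow> u a \<noteq> 0"
    and vanish: "\<And>x. (\<And>a. a \<in> A \<Longrightarrow> dot (u a) x \<noteq> 0) \<Longrightarrow> evaluate x q = 0"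
  shows "q = 0"
proof -
  obtain idx :: "'n \<Rightarrow> nat" where idx: "inj idx"
    using finite_imp_inj_to_nat_seg[of "UNIV :: 'n set"] by auto
  let ?K = "Poly_Mapping.keys q"
  let ?M = "{(m, m'). m \<in> ?K \<and> m' \<in> ?K \<and> m \<noteq> m'}"
  define r where "r = (\<lambda>(m, m'). \<Sum>i\<in>UNIV.
     monom (of_nat (Poly_Mapping.lookup m i) - of_nat (Poly_Mapping.lookup m' i) :: complex) (idx i))"
  have "finite ?M" by (rule finite_subset[of _ "?K \<times> ?K"]) auto
  moreover have "r a \<noteq> 0" if "a \<in> ?M" for a
  proof -
    obtain m m' where a: "a = (m, m')" "m \<noteq> m'" using \<open>a \<in> ?M\<close> by auto
    then obtain i where i: "Poly_Mapping.lookup m i \<noteq> Poly_Mapping.lookup m' i"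
      by (metis poly_mapping_eqI)
    have "coeff (r a) (idx i) = of_nat (Poly_Mapping.lookup m i) - of_nat (Poly_Mapping.lookup m' i)"
      using idx by (simp add: r_def a coeff_sum inj_eq)
    with i show ?thesis by auto
  qed
  ultimately obtain B :: nat where "B \<ge> 2" and B: "\<And>a. a \<in> ?M \<Longrightarrow> poly (r a) (of_nat B) \<noteq> 0"
    using nonzero_polys_common_nonroot[of ?M r 2] by auto
  define wt where "wt m = (\<Sum>i\<in>UNIV. B ^ idx i * Poly_Mapping.lookup m i)" for m
  have wt_inj: "wt m \<noteq> wt m'" if "(m, m') \<in> ?M" for m m'
  proof
    assume "wt m = wt m'"
    then have "of_nat (wt m) - of_nat (wt m') = (0::complex)" by simp
    moreover have "poly (r (m, m')) (of_nat B) = of_nat (wt m) - of_nat (wt m')"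
      by (simp add: r_def wt_def poly_sum poly_monom algebra_simps sum_subtractf)
    ultimately show False using B[OF that] by simp
  qed
  define x where "x s = (\<chi> i. s ^ (B ^ idx i))" for s :: complex
  define Q where "Q = (\<Sum>m\<in>?K. monom (Poly_Mapping.lookup q m) (wt m))"
  have Q: "poly Q s = evaluate (x s) q" for s
    by (simp add: Q_def evaluate_def x_def poly_sum poly_monom wt_def power_sum power_mult)
  define U where "U a = (\<Sum>i\<in>UNIV. monom (u a $ i) (B ^ idx i))" for a
  have U: "poly (U a) s = dot (u a) (x s)" for a s
    by (simp add: U_def dot_def x_def poly_sum poly_monom)
  have U0: "U a \<noteq> 0" if a: "a \<in> A" for a
  proof -
    obtain i where i: "u a $ i \<noteq> 0" using assms(2)[OF a] by (auto simp: vec_eq_iff)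
    have "coeff (U a) (B ^ idx i) = u a $ i"
      using idx \<open>B \<ge> 2\<close> by (simp add: U_def coeff_sum inj_eq)
    with i show ?thesis by auto
  qed
  have "poly (Q * (\<Prod>a\<in>A. U a)) s = 0" for s
  proof (cases "\<forall>a\<in>A. dot (u a) (x s) \<noteq> 0")
    case True
    then show ?thesis using vanish by (simp add: Q)
  next
    case False
    then have "\<exists>a\<in>A. poly (U a) s = 0" by (simp add: U)
    then show ?thesis using \<open>finite A\<close> by (simp add: poly_prod)
  qed
  then have "Q * (\<Prod>a\<in>A. U a) = 0" using poly_all_0_iff_0 by blast
  then have "Q = 0" using U0 \<open>finite A\<close> by simp
  have "Poly_Mapping.lookup q m = 0" for m
  proof (cases "m \<in> ?K")
    case True
    have "coeff Q (wt m) = (\<Sum>m'\<in>?K. if m' = m then Poly_Mapping.lookup q m' else 0)"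
      unfolding Q_def coeff_sum by (rule sum.cong) (use wt_inj True in auto)
    then show ?thesis using True \<open>Q = 0\<close> by simp
  qed (simp add: in_keys_iff)
  then show ?thesis by (intro poly_mapping_eqI) simp
qed


section \<open>Polarization and generic points\<close>

text \<open>An identity between \<open>N\<close>-th powers of linear forms implies the same identity between
  products of \<open>N\<close> values at independent points: each induction step differentiates the identity
  in the direction of a new point \<open>y a\<close>. For \<open>card T = N\<close> the point \<open>x\<close> disappears.\<close>
lemma polarization:
  fixes v :: "'b \<Rightarrow> complex^'n" and c :: "'b \<Rightarrow> complex"
  assumes "finite T" "card T \<le> N"
    and zero: "\<And>x. (\<Sum>s\<in>W. c s * dot (v s) x ^ N) = 0"
  shows "(\<Sum>s\<in>W. c s * dot (v s) x ^ (N - card T) * (\<Prod>t\<in>T. dot (v s) (y t))) = 0"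
  using assms(1,2)
proof (induction T arbitrary: x rule: finite_induct)
  case empty
  then show ?case using zero by simp
next
  case (insert a T)
  obtain M where M: "N - card T = Suc M"
    using insert.prems insert.hyps by (cases "N - card T") auto
  let ?k = "\<lambda>s. c s * (\<Prod>t\<in>T. dot (v s) (y t))"
  have IH: "(\<Sum>s\<in>W. ?k s * (dot (v s) x + z * dot (v s) (y a)) ^ Suc M) = 0" for z
  proof -
    have "dot (v s) (x + z *s y a) = dot (v s) x + z * dot (v s) (y a)" for s
      by (simp add: dot_def sum.distrib sum_distrib_left algebra_simps)
    then show ?thesis
      using insert.IH[of "x + z *s y a"] insert.prems insert.hyps M by (simp add: mult_ac)
  qed
  have "((\<lambda>z. \<Sum>s\<in>W. ?k s * (dot (v s) x + z * dot (v s) (y a)) ^ Suc M) has_field_derivative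
      (\<Sum>s\<in>W. ?k s * (of_nat (Suc M) * dot (v s) x ^ M * dot (v s) (y a)))) (at 0)"
  proof (rule DERIV_sum)
    fix s
    show "((\<lambda>z. ?k s * (dot (v s) x + z * dot (v s) (y a)) ^ Suc M) has_field_derivative
        ?k s * (of_nat (Suc M) * dot (v s) x ^ M * dot (v s) (y a))) (at 0)"
    proof -
      have "((\<lambda>z. dot (v s) x + z * dot (v s) (y a)) has_field_derivative dot (v s) (y a)) (at 0)"
        by (auto intro!: derivative_eq_intros)
      from DERIV_cmult[OF DERIV_power_Suc[OF this, of M], of "?k s"] show ?thesis
        by (simp add: mult_ac)
    qed
  qed
  moreover have "((\<lambda>z. \<Sum>s\<in>W. ?k s * (dot (v s) x + z * dot (v s) (y a)) ^ Suc M) has_field_derivative 0) (at 0)"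
    by (simp only: IH DERIV_const)
  ultimately have "(\<Sum>s\<in>W. ?k s * (of_nat (Suc M) * dot (v s) x ^ M * dot (v s) (y a))) = 0"
    by (rule DERIV_unique)
  also have "(\<Sum>s\<in>W. ?k s * (of_nat (Suc M) * dot (v s) x ^ M * dot (v s) (y a))) =
     of_nat (Suc M) * (\<Sum>s\<in>W. c s * dot (v s) x ^ M * (dot (v s) (y a) * (\<Prod>t\<in>T. dot (v s) (y t))))"
    by (simp add: sum_distrib_left mult_ac del: of_nat_Suc)
  finally have "(\<Sum>s\<in>W. c s * dot (v s) x ^ M * (dot (v s) (y a) * (\<Prod>t\<in>T. dot (v s) (y t)))) = 0"
    by (simp del: of_nat_Suc)
  moreover have "N - card (insert a T) = M" using insert.hyps M by simp
  ultimately show ?case using insert.hyps by simp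
qed

text \<open>A complex vector space is not a finite union of proper subspaces: if \<open>a\<close> avoids
  the kernels treated before and \<open>b\<close> the new one, then \<open>a + c *s b\<close> avoids all of them for all
  but finitely many \<open>c\<close>.\<close>
lemma common_nonroot_on_subspace:
  fixes \<phi> :: "'a \<Rightarrow> complex^'n \<Rightarrow> complex"
  assumes "finite T" "vec.subspace U"
    and "\<And>t a b c. t \<in> T \<Longrightarrow> \<phi> t (a + c *s b) = \<phi> t a + c * \<phi> t b"
    and "\<And>t. t \<in> T \<Longrightarrow> \<exists>a\<in>U. \<phi> t a \<noteq> 0"
  shows "\<exists>a\<in>U. \<forall>t\<in>T. \<phi> t a \<noteq> 0"
  using assms(1,3,4)
proof (induction T rule: finite_induct)
  case empty
  then show ?case using vec.subspace_0[OF assms(2)] by auto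
next
  case (insert s T)
  obtain a where a: "a \<in> U" "\<forall>t\<in>T. \<phi> t a \<noteq> 0" using insert by auto
  obtain b where b: "b \<in> U" "\<phi> s b \<noteq> 0" using insert.prems(2)[of s] by blast
  let ?Z = "(\<lambda>t. - \<phi> t a / \<phi> t b) ` insert s T"
  obtain c where c: "c \<notin> insert 0 ?Z"
    using ex_new_if_finite[OF infinite_UNIV_char_0[where 'a = complex], of "insert 0 ?Z"] insert.hyps
    by auto
  have "\<phi> t (a + c *s b) \<noteq> 0" if t: "t \<in> insert s T" for t
  proof (cases "\<phi> t b = 0")
    case True
    then have "\<phi> t a \<noteq> 0" using a b t by auto
    then show ?thesis using insert.prems(1)[OF t] True by simp
  next
    case False
    have "c \<noteq> - \<phi> t a / \<phi> t b" using c t by blast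
    then have "c * \<phi> t b \<noteq> - \<phi> t a" using False by (simp add: field_simps)
    then show ?thesis using insert.prems(1)[OF t]
      by (simp add: eq_neg_iff_add_eq_0 add.commute)
  qed
  moreover have "a + c *s b \<in> U"
    using a b assms(2) by (intro vec.subspace_add vec.subspace_scale)
  ultimately show ?case by blast
qed

section \<open>Divisibility of complex polynomials in one variable\<close>

text \<open>The sum of a nontrivial character: \<open>Z\<close> has too many elements for \<open>z \<mapsto> z ^ j\<close> to be trivial
  on it, and multiplying by an \<open>h\<close> with \<open>h ^ j \<noteq> 1\<close> permutes \<open>Z\<close>.\<close>
lemma power_sum_mult_closed_eq_0:
  fixes Z :: "complex set"
  assumes "finite Z" "0 \<notin> Z" and closed: "\<And>a b. a \<in> Z \<Longrightarrow> b \<in> Z \<Longrightarrow> a * b \<in> Z"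
    and "0 < j" "j < card Z"
  shows "(\<Sum>z\<in>Z. z ^ j) = 0"
proof -
  have "\<not> Z \<subseteq> {z. z ^ j = 1}"
    using card_mono[OF finite_roots_unity, of j Z] card_roots_unity[of j, where 'a = complex] assms
    by auto
  then obtain h where h: "h \<in> Z" "h ^ j \<noteq> 1" by auto
  have inj: "inj_on ((*) h) Z" using h assms(2) by (auto simp: inj_on_def)
  moreover have "(*) h ` Z \<subseteq> Z" using closed h by auto
  ultimately have im: "(*) h ` Z = Z" using endo_inj_surj assms(1) by blast
  have "(\<Sum>z\<in>Z. z ^ j) = (\<Sum>z\<in>(*) h ` Z. z ^ j)" by (simp add: im)
  also have "\<dots> = h ^ j * (\<Sum>z\<in>Z. z ^ j)"
    by (simp add: sum.reindex[OF inj] power_mult_distrib sum_distrib_left)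
  finally show ?thesis using h(2) by simp
qed

text \<open>In the binomial expansion the coefficient of \<open>B ^ k\<close> contains the factor
  \<open>\<Sum>z\<in>Z. z ^ Suc k\<close>, which vanishes for \<open>Suc k < card Z\<close>. This is the averaging
  over a cyclic reflection group that makes skew polynomials divisible by powers of the root.\<close>
lemma dvd_twisted_power_sum:
  fixes A B :: "complex poly"
  assumes "finite Z" "0 \<notin> Z" "\<And>a b. a \<in> Z \<Longrightarrow> b \<in> Z \<Longrightarrow> a * b \<in> Z"
  shows "B ^ (card Z - 1) dvd (\<Sum>z\<in>Z. smult z ((A + smult z B) ^ N))"
proof -
  have "(\<Sum>z\<in>Z. smult z ((A + smult z B) ^ N)) =
      (\<Sum>z\<in>Z. \<Sum>k\<le>N. smult (z ^ Suc k) (of_nat (N choose k) * B ^ k * A ^ (N - k)))"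
  proof (rule sum.cong)
    fix z
    have "smult z ((A + smult z B) ^ N) =
        smult z (\<Sum>k\<le>N. of_nat (N choose k) * smult z B ^ k * A ^ (N - k))"
      by (simp only: binomial_ring[symmetric] add.commute)
    also have "\<dots> = (\<Sum>k\<le>N. [:z:] * (of_nat (N choose k) * smult z B ^ k * A ^ (N - k)))"
      unfolding sum_distrib_left[symmetric] by simp
    also have "\<dots> = (\<Sum>k\<le>N. smult (z ^ Suc k) (of_nat (N choose k) * B ^ k * A ^ (N - k)))"
      by (simp add: smult_power mult_ac)
    finally show "smult z ((A + smult z B) ^ N) =
        (\<Sum>k\<le>N. smult (z ^ Suc k) (of_nat (N choose k) * B ^ k * A ^ (N - k)))" .
  qed simp
  also have "\<dots> = (\<Sum>k\<le>N. smult (\<Sum>z\<in>Z. z ^ Suc k) (of_nat (N choose k) * B ^ k * A ^ (N - k)))"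
    by (subst sum.swap) (simp only: smult_sum)
  also have "B ^ (card Z - 1) dvd \<dots>"
  proof (rule dvd_sum)
    fix k
    show "B ^ (card Z - 1) dvd smult (\<Sum>z\<in>Z. z ^ Suc k) (of_nat (N choose k) * B ^ k * A ^ (N - k))"
    proof (cases "Suc k < card Z")
      case True
      then show ?thesis using power_sum_mult_closed_eq_0[OF assms, of "Suc k"] by simp
    next
      case False
      then have "B ^ (card Z - 1) dvd B ^ k" by (intro le_imp_power_dvd) simp
      then show ?thesis by (intro dvd_smult dvd_mult2 dvd_mult)
    qed
  qed
  finally show ?thesis .
qed

text \<open>Powers of distinct monic linear factors are coprime; the argument is phrased by
  orders of vanishing.\<close>
lemma prod_linear_powers_dvd:
  fixes P :: "complex poly"
  assumes "finite R" "\<And>r. r \<in> R \<Longrightarrow> [:-r, 1:] ^ k r dvd P"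
  shows "(\<Prod>r\<in>R. [:-r, 1:] ^ k r) dvd P"
proof (cases "P = 0")
  case False
  show ?thesis using assms
  proof (induction R rule: finite_induct)
    case (insert a R)
    let ?Q = "\<Prod>r\<in>R. [:-r, 1:] ^ k r"
    obtain S where S: "P = ?Q * S" using insert by (auto elim: dvdE)
    have "poly ?Q a \<noteq> 0" using insert.hyps by (auto simp: poly_prod)
    then have "Polynomial.order a P = Polynomial.order a S"
      using False S order_mult[of ?Q S a] by (simp add: order_0I)
    moreover have "k a \<le> Polynomial.order a P"
      using insert.prems[of a] False by (simp add: order_divides)
    ultimately have "[:-a, 1:] ^ k a dvd S" by (simp add: order_divides)
    then show ?case using insert.hyps S by (simp add: mult.commute mult_dvd_mono)
  qed simp
qed simp

text \<open>The condition \<open>a s * b t = a t * b s\<close> says that the two linear polynomials have the same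
  root, so that the product groups into powers of distinct linear factors.\<close>
lemma prod_linear_dvd:
  fixes P :: "complex poly" and a b :: "'a \<Rightarrow> complex"
  assumes "finite T" "\<And>t. t \<in> T \<Longrightarrow> b t \<noteq> 0"
    and "\<And>t. t \<in> T \<Longrightarrow> [:a t, b t:] ^ card {s\<in>T. a s * b t = a t * b s} dvd P"
  shows "(\<Prod>t\<in>T. [:a t, b t:]) dvd P"
proof -
  define \<rho> where "\<rho> t = - a t / b t" for t
  have lin: "[:a t, b t:] = smult (b t) [:- \<rho> t, 1:]" if "t \<in> T" for t
    using assms(2)[OF that] by (simp add: \<rho>_def)
  have same_root: "{s\<in>T. \<rho> s = \<rho> t} = {s\<in>T. a s * b t = a t * b s}" if "t \<in> T" for t
    using assms(2) that by (auto simp: \<rho>_def field_simps)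
  have "(\<Prod>t\<in>T. [:a t, b t:]) = (\<Prod>t\<in>T. smult (b t) [:- \<rho> t, 1:])"
    by (rule prod.cong) (simp_all only: lin)
  also have "\<dots> = smult (\<Prod>t\<in>T. b t) (\<Prod>t\<in>T. [:- \<rho> t, 1:])"
    by (rule prod_smult)
  also have "(\<Prod>t\<in>T. [:- \<rho> t, 1:]) = (\<Prod>r\<in>\<rho> ` T. \<Prod>t\<in>{t\<in>T. \<rho> t = r}. [:- \<rho> t, 1:])"
    using prod.group[of T "\<rho> ` T" \<rho> "\<lambda>t. [:- \<rho> t, 1:]"] assms(1) by simp
  also have "\<dots> = (\<Prod>r\<in>\<rho> ` T. [:- r, 1:] ^ card {t\<in>T. \<rho> t = r})"
    by simp
  finally have eq: "(\<Prod>t\<in>T. [:a t, b t:]) =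
      smult (\<Prod>t\<in>T. b t) (\<Prod>r\<in>\<rho> ` T. [:- r, 1:] ^ card {t\<in>T. \<rho> t = r})" .
  have "(\<Prod>r\<in>\<rho> ` T. [:- r, 1:] ^ card {t\<in>T. \<rho> t = r}) dvd P"
  proof (rule prod_linear_powers_dvd)
    fix r assume "r \<in> \<rho> ` T"
    then obtain t where t: "t \<in> T" "r = \<rho> t" by auto
    have "[:- \<rho> t, 1:] dvd [:a t, b t:]" by (simp only: lin[OF t(1)] dvd_smult dvd_refl)
    then have "[:- \<rho> t, 1:] ^ card {s\<in>T. \<rho> s = \<rho> t} dvd [:a t, b t:] ^ card {s\<in>T. \<rho> s = \<rho> t}"
      by (rule dvd_power_same)
    then show "[:- r, 1:] ^ card {t\<in>T. \<rho> t = r} dvd P"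
      using assms(3)[OF t(1)] t same_root[OF t(1)] by (auto intro: dvd_trans)
  qed (use assms in simp)
  then show ?thesis unfolding eq using assms(1,2) by (intro smult_dvd) auto
qed

lemma coeff_prod_linear:
  fixes a b :: "'a \<Rightarrow> complex"
  shows "degree (\<Prod>t\<in>A. [:a t, b t:]) \<le> card A \<and>
    coeff (\<Prod>t\<in>A. [:a t, b t:]) (card A) = (\<Prod>t\<in>A. b t)"
proof (induction A rule: infinite_finite_induct)
  case (insert t A)
  let ?q = "\<Prod>t\<in>A. [:a t, b t:]"
  have "degree ([:a t, b t:] * ?q) \<le> Suc (card A)"
    using degree_mult_le[of "[:a t, b t:]" ?q] insert.IH by (simp split: if_splits)
  moreover have "coeff ([:a t, b t:] * ?q) (Suc (card A)) = b t * coeff ?q (card A)"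
    using insert.IH by (simp add: coeff_eq_0)
  ultimately show ?case
    unfolding prod.insert[OF insert.hyps] card_insert_disjoint[OF insert.hyps]
    using insert.IH by metis
qed auto

lemma coeff_linear_power:
  fixes a b :: complex
  shows "degree ([:a, b:] ^ N) \<le> N" "coeff ([:a, b:] ^ N) N = b ^ N"
  using coeff_prod_linear[where A = "{..<N}" and a = "\<lambda>_. a" and b = "\<lambda>_. b"] by simp_all

section \<open>Linear algebra of reflections\<close>

text \<open>A basis that consists of \<open>l\<close> and vectors of the kernel of \<open>\<lambda>x. dot x y\<close> diagonalizes \<open>t\<close>.
  Such a basis (the columns of \<open>P\<close>) arises from the standard one by projecting onto this
  kernel along \<open>l\<close>, and by replacing one basis vector, at a nonzero coordinate of \<open>l\<close>, by \<open>l\<close>.\<close>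
lemma det_homology:
  fixes t :: "complex^'n^'n"
  assumes t: "\<And>x. t *v x = x + ((c - 1) * dot x y) *s l" and ly: "dot l y = 1"
  shows "det t = c"
proof -
  have "l \<noteq> 0" using ly by (auto simp: dot_def)
  then obtain k where k: "l $ k \<noteq> 0" by (auto simp: vec_eq_iff)
  define p where "p j = (if j = k then l else axis j 1 - y $ j *s l)" for j
  define P :: "complex^'n^'n" where "P = (\<chi> i j. p j $ i)"
  define E :: "complex^'n^'n" where "E = (\<chi> i j. if i = j then (if j = k then c else 1) else 0)"
  have dot_axis: "dot (axis j 1) y = y $ j" for j
    by (simp add: dot_def axis_def if_distrib if_distribR cong: if_cong)
  have dot_p: "dot (p j) y = (if j = k then 1 else 0)" for j
    using ly dot_axis[of j]
    by (simp add: p_def dot_def left_diff_distrib sum_subtractf mult.assoc flip: sum_distrib_left)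
  have tp: "t *v p j = (if j = k then c else 1) *s p j" for j
    by (simp add: t dot_p) (simp add: p_def algebra_simps vec_eq_iff)
  have "t ** P = P ** E"
  proof -
    have "(t ** P) $ i $ j = (t *v p j) $ i" for i j
      by (simp add: matrix_matrix_mult_def matrix_vector_mult_def P_def)
    moreover have "(P ** E) $ i $ j = (if j = k then c else 1) * p j $ i" for i j
      by (simp add: matrix_matrix_mult_def P_def E_def if_distrib cong: if_cong)
    ultimately show ?thesis by (simp add: vec_eq_iff tp)
  qed
  then have "det t * det P = det P * det E" by (metis det_mul)
  moreover have "det E = c"
    by (subst det_diagonal) (auto simp: E_def)
  moreover have "det P \<noteq> 0"
  proof -
    have "x = 0" if "P *v x = 0" for x
    proof -
      define a where "a = x $ k - (\<Sum>j\<in>UNIV-{k}. x $ j * y $ j)"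
      have comp: "(if i = k then 0 else x $ i) + a * l $ i = 0" for i
      proof -
        have "0 = (\<Sum>j\<in>UNIV. p j $ i * x $ j)"
          using that by (simp add: matrix_vector_mult_def P_def vec_eq_iff)
        also have "\<dots> = l $ i * x $ k + (\<Sum>j\<in>UNIV-{k}. (axis j 1 $ i - y $ j * l $ i) * x $ j)"
          by (subst sum.remove[of _ k]) (auto simp: p_def)
        also have "(\<Sum>j\<in>UNIV-{k}. (axis j 1 $ i - y $ j * l $ i) * x $ j) =
           (\<Sum>j\<in>UNIV-{k}. if j = i then x $ j else 0) - (\<Sum>j\<in>UNIV-{k}. x $ j * y $ j) * l $ i"
          unfolding sum_distrib_right sum_subtractf[symmetric]
          by (rule sum.cong) (auto simp: axis_def algebra_simps)
        also have "(\<Sum>j\<in>UNIV-{k}. if j = i then x $ j else 0) = (if i = k then 0 else x $ i)"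
          by auto
        finally show ?thesis by (simp add: a_def algebra_simps)
      qed
      from comp[of k] k have "a = 0" by simp
      then have other: "x $ i = 0" if "i \<noteq> k" for i using comp[of i] that by simp
      then have "x $ k = 0" using \<open>a = 0\<close> by (simp add: a_def)
      with other show ?thesis by (metis vec_eq_iff zero_index)
    qed
    then have "\<exists>B. B ** P = mat 1"
      unfolding matrix_left_invertible_ker by blast
    then show ?thesis
      by (simp add: invertible_left_inverse flip: invertible_det_nz)
  qed
  ultimately show ?thesis by simp
qed


lemma hyperplane_complement:
  fixes H :: "(complex^'n) set"
  assumes "hyperplane H" "l \<notin> H"
  shows "\<exists>a. x - a *s l \<in> H"
proof -
  have "vec.span H = H" using assms(1) by (simp add: hyperplane_def vec.span_eq_iff)
  then have "l \<notin> vec.span H" using assms(2) by metis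
  then have "vec.dim (insert l H) = CARD('n)"
    using assms by (simp add: hyperplane_def vec.dim_insert)
  then have "x \<in> vec.span (insert l H)"
    by (metis UNIV_I vec.dim_eq_full vec_dim_card vec.span_UNIV)
  then show ?thesis
    unfolding vec.span_breakdown_eq \<open>vec.span H = H\<close> .
qed

section \<open>The invariant Hermitian form of a finite matrix group\<close>

locale matrix_group =
  fixes W :: "(complex^'n^'n) set"
  assumes subgroup: "subgroup W GL" and fin [simp]: "finite W"
begin

lemma one_in: "mat 1 \<in> W"
  using subgroup.one_closed[OF subgroup] by (simp add: GL_def)

lemma mult_in: "s \<in> W \<Longrightarrow> t \<in> W \<Longrightarrow> s ** t \<in> W"
  using subgroup.m_closed[OF subgroup] by (simp add: GL_def)

lemma inverse_in:
  assumes "s \<in> W"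
  obtains s' where "s' \<in> W" "s ** s' = mat 1" "s' ** s = mat 1"
proof -
  interpret GL: group "GL :: (complex^'n^'n) monoid" by (rule group_GL)
  have "s \<in> carrier GL" using assms subgroup.subset[OF subgroup] by auto
  then show ?thesis
    using that[of "inv\<^bsub>GL\<^esub> s"] GL.r_inv[of s] GL.l_inv[of s] subgroup.m_inv_closed[OF subgroup assms]
    by (simp add: GL_def)
qed

lemma det_nz: "s \<in> W \<Longrightarrow> det s \<noteq> 0"
  by (metis det_I det_mul inverse_in mult_zero_left zero_neq_one)

lemma finite_order:
  assumes "s \<in> W"
  shows "\<exists>k::nat. k > 0 \<and> s [^]\<^bsub>GL\<^esub> k = \<one>\<^bsub>GL\<^esub>"
proof -
  interpret GL: group "GL :: (complex^'n^'n) monoid" by (rule group_GL)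
  have "s [^]\<^bsub>GL\<^esub> k \<in> W" for k :: nat
    by (induction k) (use one_in mult_in assms in \<open>auto simp: nat_pow_def GL_def\<close>)
  then have "finite (range (\<lambda>k::nat. s [^]\<^bsub>GL\<^esub> k))"
    by (intro finite_subset[OF _ fin]) auto
  then have "\<not> inj (\<lambda>k::nat. s [^]\<^bsub>GL\<^esub> k)"
    using finite_imageD infinite_UNIV_nat by blast
  then obtain i j :: nat where "i < j" "s [^]\<^bsub>GL\<^esub> j = s [^]\<^bsub>GL\<^esub> i"
    unfolding inj_on_def by (metis linorder_neqE_nat)
  then have "j - i > 0" "s [^]\<^bsub>GL\<^esub> (j - i) = \<one>\<^bsub>GL\<^esub>"
    using GL.pow_eq_div2[of s j i] assms subgroup.subset[OF subgroup] by auto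
  then show ?thesis by blast
qed

lemma bij_mult_left: 
  assumes "s \<in> W" shows "bij_betw (\<lambda>t. s ** t) W W"
proof -
  obtain s' where s': "s' \<in> W" "s ** s' = mat 1" "s' ** s = mat 1" using assms by (rule inverse_in)
  show ?thesis
    by (rule bij_betw_byWitness[of _ "\<lambda>t. s' ** t"])
       (use assms s' in \<open>auto simp: matrix_mul_assoc mult_in\<close>)
qed

lemma bij_mult_right: 
  assumes "s \<in> W" shows "bij_betw (\<lambda>t. t ** s) W W"
proof -
  obtain s' where s': "s' \<in> W" "s ** s' = mat 1" "s' ** s = mat 1" using assms by (rule inverse_in)
  show ?thesis
    by (rule bij_betw_byWitness[of _ "\<lambda>t. t ** s'"])
       (use assms s' in \<open>auto simp: mult_in simp flip: matrix_mul_assoc\<close>)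
qed

definition herm :: "complex^'n \<Rightarrow> complex^'n \<Rightarrow> complex" where
  "herm x y = (\<Sum>s\<in>W. \<Sum>i\<in>UNIV. (s *v x) $ i * cnj ((s *v y) $ i))"

lemma herm_add_left: "herm (x + y) z = herm x z + herm y z"
  by (simp add: herm_def matrix_vector_right_distrib algebra_simps sum.distrib)

lemma herm_scale_left: "herm (c *s x) z = c * herm x z"
  by (simp add: herm_def vector_scalar_commute sum_distrib_left algebra_simps)

lemma herm_diff_left: "herm (x - y) z = herm x z - herm y z"
  by (simp add: herm_def matrix_vector_mult_diff_distrib algebra_simps sum_subtractf)

lemma herm_cnj: "cnj (herm x y) = herm y x"
  by (simp add: herm_def mult.commute)

lemma herm_scale_right: "herm x (c *s z) = cnj c * herm x z"
  by (metis complex_cnj_mult herm_cnj herm_scale_left)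

lemma herm_diff_right: "herm x (y - z) = herm x y - herm x z"
  by (metis complex_cnj_diff herm_cnj herm_diff_left)

lemmas herm_simps = herm_add_left herm_scale_left herm_diff_left herm_scale_right herm_diff_right

lemma herm_0_left [simp]: "herm 0 x = 0"
  using herm_scale_left[of 0 0 x] by simp

lemma herm_invariant:
  assumes "t \<in> W" shows "herm (t *v x) (t *v y) = herm x y"
  unfolding herm_def matrix_vector_mul_assoc
  by (rule sum.reindex_bij_betw[OF bij_mult_right[OF assms]])

lemma herm_eq_0D:
  assumes "herm x x = 0" shows "x = 0"
proof -
  have nn: "(\<Sum>i\<in>UNIV. (cmod ((s *v x) $ i))\<^sup>2) \<ge> 0" for s by (simp add: sum_nonneg)
  have "complex_of_real (\<Sum>s\<in>W. \<Sum>i\<in>UNIV. (cmod ((s *v x) $ i))\<^sup>2) = herm x x"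
    unfolding herm_def by (simp flip: complex_norm_square)
  then have "(\<Sum>s\<in>W. \<Sum>i\<in>UNIV. (cmod ((s *v x) $ i))\<^sup>2) = 0"
    using assms by (metis of_real_eq_0_iff)
  then have "\<forall>s\<in>W. (\<Sum>i\<in>UNIV. (cmod ((s *v x) $ i))\<^sup>2) = 0"
    using nn by (subst (asm) sum_nonneg_eq_0_iff) auto
  then have "(\<Sum>i\<in>UNIV. (cmod ((mat 1 *v x) $ i))\<^sup>2) = 0"
    using one_in by blast
  then show ?thesis by (simp add: sum_nonneg_eq_0_iff vec_eq_iff)
qed

text \<open>The vector that represents the linear functional \<open>\<lambda>x. herm x l\<close> under the bilinear pairing.\<close>
definition dual :: "complex^'n \<Rightarrow> complex^'n" where
  "dual l = (\<chi> i. herm (axis i 1) l)"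

lemma herm_eq_dot: "herm x l = dot x (dual l)"
proof -
  have "herm (\<Sum>i\<in>A. x $ i *s axis i 1) l = (\<Sum>i\<in>A. x $ i * herm (axis i 1) l)" for A
    by (induction A rule: infinite_finite_induct) (auto simp: herm_simps)
  from this[of UNIV] show ?thesis
    by (simp add: dot_def dual_def basis_expansion)
qed

end

section \<open>Reflections and their roots\<close>

locale reflections = matrix_group W for W :: "(complex^'n^'n) set" +
  fixes l :: "complex^'n^'n \<Rightarrow> complex^'n"
  assumes eigenvectors: "\<And>t. t \<in> pseudo_reflections W \<Longrightarrow> \<exists>c. c \<noteq> 1 \<and> eigenvector t c (l t)"
begin

abbreviation T where "T \<equiv> pseudo_reflections W"

lemma T_subset: "t \<in> T \<Longrightarrow> t \<in> W" by (simp add: pseudo_reflections_def)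

lemma finite_T [simp]: "finite T"
  using finite_subset[of T W] T_subset by auto

text \<open>Invariance of the form makes the eigenvectors of a reflection for the distinct
  eigenvalues orthogonal. Hence the reflecting hyperplane is the orthogonal complement of
  the root \<open>l t\<close>, and the reflection is determined by its root and its determinant.\<close>
lemma reflection:
  assumes t: "t \<in> T"
  shows reflection_eq: "t *v x = x + ((det t - 1) * (herm x (l t) / herm (l t) (l t))) *s l t"
    and det_reflection: "det t \<noteq> 1"
    and hyperplane_reflection: "hyperplane {x. herm x (l t) = 0}"
    and root_nz: "herm (l t) (l t) \<noteq> 0"
proof -
  let ?l = "l t"
  obtain c where c: "c \<noteq> 1" "?l \<noteq> 0" "t *v ?l = c *s ?l"
    using eigenvectors[OF t] by (auto simp: eigenvector_def)
  obtain H where H: "hyperplane H" "\<And>h. h \<in> H \<Longrightarrow> t *v h = h"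
    using t by (auto simp: pseudo_reflections_def pseudo_reflection_def fixes_hyperplane_def)
  show nz: "herm ?l ?l \<noteq> 0" using herm_eq_0D c by auto
  have "?l \<notin> H" using H(2)[of ?l] c by (auto simp: vec_eq_iff)
  have orth: "herm h ?l = 0" if "h \<in> H" for h
  proof -
    have "herm ?l h = herm (t *v ?l) (t *v h)" using herm_invariant T_subset[OF t] by simp
    also have "\<dots> = c * herm ?l h" using H(2)[OF that] c by (simp add: herm_simps)
    finally have "herm ?l h = 0" using c(1) by simp
    then show ?thesis by (metis herm_cnj complex_cnj_zero)
  qed
  have proj: "x - (herm x ?l / herm ?l ?l) *s ?l \<in> H" for x
  proof -
    obtain a where a: "x - a *s ?l \<in> H" using hyperplane_complement[OF H(1) \<open>?l \<notin> H\<close>] by blast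
    then have "a = herm x ?l / herm ?l ?l" using orth[OF a] nz by (simp add: herm_simps)
    with a show ?thesis by simp
  qed
  have "x \<in> H \<longleftrightarrow> herm x ?l = 0" for x
    using proj[of x] orth by auto
  then have "H = {x. herm x ?l = 0}" by blast
  with H show "hyperplane {x. herm x ?l = 0}" by simp
  have tx: "t *v x = x + ((c - 1) * (herm x ?l / herm ?l ?l)) *s ?l" for x
  proof -
    define a where "a = herm x ?l / herm ?l ?l"
    have "t *v x = t *v (x - a *s ?l) + t *v (a *s ?l)"
      by (simp flip: matrix_vector_right_distrib)
    also have "\<dots> = (x - a *s ?l) + (a * c) *s ?l"
      using H(2)[OF proj[of x, folded a_def]] c by (simp add: vector_scalar_commute vector_smult_assoc)
    also have "\<dots> = x + ((c - 1) * a) *s ?l"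
      by (simp add: vec_eq_iff algebra_simps)
    finally show ?thesis by (simp add: a_def)
  qed
  have "det t = c"
  proof (rule det_homology)
    have "dot x ((1 / herm ?l ?l) *s dual ?l) = herm x ?l / herm ?l ?l" for x
      by (simp add: herm_eq_dot dot_def sum_divide_distrib)
    then show "dot ?l ((1 / herm ?l ?l) *s dual ?l) = 1"
      and "t *v x = x + ((c - 1) * dot x ((1 / herm ?l ?l) *s dual ?l)) *s ?l" for x
      using nz tx by simp_all
  qed
  then show "t *v x = x + ((det t - 1) * (herm x ?l / herm ?l ?l)) *s ?l" "det t \<noteq> 1"
    using tx c by simp_all
qed

lemma reflectionI:
  assumes "s \<in> W" "s \<noteq> mat 1" "hyperplane H" "\<And>h. h \<in> H \<Longrightarrow> s *v h = h"
  shows "s \<in> T"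
  using assms finite_order[of s] subgroup.subset[OF subgroup]
  by (auto simp: pseudo_reflections_def pseudo_reflection_def fixes_hyperplane_def GL_def)

text \<open>The pointwise stabilizer in \<open>W\<close> of the reflecting hyperplane of \<open>t\<close>: a cyclic group that consists
  of the identity and the reflections whose root is parallel to \<open>l t\<close>.\<close>
definition fixator :: "complex^'n^'n \<Rightarrow> (complex^'n^'n) set" where
  "fixator t = {s\<in>W. \<forall>x. herm x (l t) = 0 \<longrightarrow> s *v x = x}"

lemma fixator_reflection: "t \<in> T \<Longrightarrow> s \<in> fixator t \<Longrightarrow> s \<noteq> mat 1 \<Longrightarrow> s \<in> T"
  by (rule reflectionI[of s "{x. herm x (l t) = 0}"])
     (auto simp: fixator_def hyperplane_reflection)

lemma reflection_in_fixator: "t \<in> T \<Longrightarrow> t \<in> fixator t"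
  by (simp add: fixator_def T_subset reflection_eq)

text \<open>The witness is the component of \<open>l s\<close> orthogonal to \<open>l t\<close>.\<close>
lemma non_parallel_roots:
  assumes "t \<in> T" "s \<in> T" "\<nexists>a. l s = a *s l t"
  shows "\<exists>x. herm x (l t) = 0 \<and> herm x (l s) \<noteq> 0"
proof -
  define a where "a = herm (l s) (l t) / herm (l t) (l t)"
  define x where "x = l s - a *s l t"
  have x: "herm x (l t) = 0" using root_nz[OF assms(1)] by (simp add: x_def a_def herm_simps)
  have "x \<noteq> 0" using assms(3) by (auto simp: x_def)
  have "herm x x = herm x (l s) - cnj a * herm x (l t)"
    by (metis herm_diff_right herm_scale_right x_def)
  then show ?thesis using x \<open>x \<noteq> 0\<close> herm_eq_0D by auto
qed

lemma in_fixator_iff: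
  assumes "t \<in> T" "s \<in> T"
  shows "s \<in> fixator t \<longleftrightarrow> (\<exists>a. l s = a *s l t)"
proof
  assume "s \<in> fixator t"
  then have "herm x (l s) = 0" if "herm x (l t) = 0" for x
    using that reflection_eq[OF assms(2), of x] det_reflection[OF assms(2)] root_nz[OF assms(2)]
    by (auto simp: fixator_def)
  then show "\<exists>a. l s = a *s l t" using non_parallel_roots[OF assms] by blast
next
  assume "\<exists>a. l s = a *s l t"
  then show "s \<in> fixator t"
    using T_subset[OF assms(2)] by (auto simp: fixator_def reflection_eq[OF assms(2)] herm_simps)
qed

lemma fixator_eq:
  assumes t: "t \<in> T" and s: "s \<in> fixator t"
  shows "s *v x = x + ((det s - 1) * (herm x (l t) / herm (l t) (l t))) *s l t"
proof (cases "s = mat 1")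
  case False
  then have "s \<in> T" using fixator_reflection t s by blast
  then obtain a where a: "l s = a *s l t" using in_fixator_iff t s by blast
  have "a \<noteq> 0" using root_nz[OF \<open>s \<in> T\<close>] a by auto
  then have "herm x (l s) / herm (l s) (l s) * a = herm x (l t) / herm (l t) (l t)"
    using root_nz[OF t] by (simp add: a herm_simps)
  moreover have "s *v x = x + ((det s - 1) * (herm x (l s) / herm (l s) (l s) * a)) *s l t"
    using reflection_eq[OF \<open>s \<in> T\<close>, of x] unfolding a
    by (simp only: vector_smult_assoc mult.assoc)
  ultimately show ?thesis by simp
qed (simp)

lemma fixator_subset: "s \<in> fixator t \<Longrightarrow> s \<in> W" by (simp add: fixator_def)

lemma finite_fixator [simp]: "finite (fixator t)"
  using finite_subset[of "fixator t" W] by (auto simp: fixator_def)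

lemma one_in_fixator: "mat 1 \<in> fixator t" by (simp add: fixator_def one_in)

lemma mult_in_fixator: "s \<in> fixator t \<Longrightarrow> s' \<in> fixator t \<Longrightarrow> s ** s' \<in> fixator t"
  by (simp add: fixator_def mult_in flip: matrix_vector_mul_assoc)

lemma inverse_in_fixator:
  assumes "s \<in> fixator t" "s' \<in> W" "s' ** s = mat 1"
  shows "s' \<in> fixator t"
proof -
  have "s' *v x = x" if "herm x (l t) = 0" for x
  proof -
    have "s' *v (s *v x) = x" using assms(3) by (simp add: matrix_vector_mul_assoc)
    moreover have "s *v x = x" using assms(1) that by (simp add: fixator_def)
    ultimately show ?thesis by simp
  qed
  with assms(2) show ?thesis by (simp add: fixator_def)
qed

lemma inj_det_fixator: "t \<in> T \<Longrightarrow> inj_on det (fixator t)"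
  by (rule inj_onI) (simp add: matrix_eq fixator_eq)

lemma card_fixator:
  assumes t: "t \<in> T"
  shows "card (fixator t) = Suc (card (T \<inter> fixator t))"
proof -
  have "mat 1 \<notin> T" by (simp add: pseudo_reflections_def pseudo_reflection_def GL_def)
  then have "fixator t = insert (mat 1) (T \<inter> fixator t)" "mat 1 \<notin> T \<inter> fixator t"
    using fixator_reflection[OF t] one_in_fixator by auto
  then show ?thesis by (metis card_insert_disjoint finite_Int finite_T)
qed

text \<open>Multiplication by \<open>t\<close> permutes its fixator; comparing the products of all determinants
  gives the claim.\<close>
lemma det_power_card_fixator:
  assumes t: "t \<in> T"
  shows "det t ^ card (fixator t) = 1"
proof -
  have inj: "inj_on ((**) t) (fixator t)"
    by (rule inj_on_subset[OF bij_betw_imp_inj_on[OF bij_mult_left[OF T_subset[OF t]]]])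
       (auto dest: fixator_subset)
  moreover have "(**) t ` fixator t \<subseteq> fixator t"
    using mult_in_fixator reflection_in_fixator[OF t] by auto
  ultimately have im: "(**) t ` fixator t = fixator t"
    by (intro endo_inj_surj inj) simp_all
  have "(\<Prod>s\<in>fixator t. det s) = (\<Prod>s\<in>(**) t ` fixator t. det s)" by (simp add: im)
  also have "\<dots> = det t ^ card (fixator t) * (\<Prod>s\<in>fixator t. det s)"
    by (simp add: prod.reindex[OF inj] det_mul prod.distrib)
  finally have "(det t ^ card (fixator t) - 1) * (\<Prod>s\<in>fixator t. det s) = 0"
    by (simp add: left_diff_distrib)
  moreover have "(\<Prod>s\<in>fixator t. det s) \<noteq> 0"
    using det_nz fixator_subset by (subst prod_zero_iff) auto
  ultimately show ?thesis by simp
qed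

end


context reflections
begin

text \<open>Conjugation permutes the reflections, and their roots up to scalars.\<close>
lemma conj_reflection:
  assumes t: "t \<in> T" and s: "s \<in> W" "s' \<in> W" "s ** s' = mat 1" "s' ** s = mat 1"
  shows "s ** t ** s' \<in> T" and "\<exists>k. s *v l t = k *s l (s ** t ** s')"
proof -
  let ?t = "s ** t ** s'"
  have ss: "s' *v (s *v x) = x" for x
    by (simp add: matrix_vector_mul_assoc s)
  define H where "H = (*v) s ` {x. herm x (l t) = 0}"
  have inj: "inj_on ((*v) s) A" for A
    by (rule inj_on_inverseI[of _ "(*v) s'"]) (simp add: ss)
  have H: "hyperplane H"
    using hyperplane_reflection[OF t] unfolding hyperplane_def H_def
    by (simp add: vec.linear_subspace_image vec.dim_image_eq inj)
  have fix_H: "?t *v h = h" if "h \<in> H" for h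
    using that ss by (auto simp: H_def reflection_eq[OF t] simp flip: matrix_vector_mul_assoc)
  have "?t \<noteq> mat 1"
  proof
    assume "?t = mat 1"
    then have "s' ** ?t ** s = mat 1" by (simp add: s)
    then have "t = mat 1" using s by (metis matrix_mul_assoc matrix_mul_lid matrix_mul_rid)
    then show False using det_reflection[OF t] by simp
  qed
  then show T: "?t \<in> T"
    using H fix_H by (intro reflectionI mult_in s T_subset[OF t])
  define v where "v = s *v l t"
  have "t *v l t = det t *s l t"
    using root_nz[OF t] by (simp add: reflection_eq[OF t] vec_eq_iff algebra_simps)
  then have "?t *v v = det t *s v"
    by (simp add: v_def ss vector_scalar_commute flip: matrix_vector_mul_assoc)
  then have eq: "(det t - 1) *s v = ((det ?t - 1) * (herm v (l ?t) / herm (l ?t) (l ?t))) *s l ?t"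
    using reflection_eq[OF T, of v] by (simp add: vec_eq_iff algebra_simps)
  have "v = (inverse (det t - 1) * (det t - 1)) *s v"
    using det_reflection[OF t] by simp
  then have "v = inverse (det t - 1) *s (((det ?t - 1) * (herm v (l ?t) / herm (l ?t) (l ?t))) *s l ?t)"
    by (simp only: vector_smult_assoc[symmetric] eq)
  then show "\<exists>k. s *v l t = k *s l ?t"
    unfolding v_def[symmetric] vector_smult_assoc by blast
qed

section \<open>The product of the roots is skew\<close>

text \<open>The complex conjugate of the value of the product of the roots at the linear functional
  \<open>\<lambda>v. herm v x\<close>, hence a function on the space itself rather than on its dual.\<close>
definition skew :: "complex^'n \<Rightarrow> complex" where
  "skew x = (\<Prod>t\<in>T. herm x (l t))"

text \<open>The roots parallel to \<open>l t\<close> contribute the factor \<open>det t\<close> once for every nontrivial element of the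
  fixator, which is one time less than the \<open>card (fixator t)\<close> times that give \<open>1\<close>. The other roots
  are permuted up to scalars, so their product changes by a constant \<open>\<kappa>\<close>; evaluation at a point
  of the reflecting hyperplane that lies on no other one shows \<open>\<kappa> = 1\<close>.\<close>
lemma skew_reflection:
  assumes t: "t \<in> T"
  shows "det t * skew (t *v x) = skew x"
proof -
  let ?F = "T \<inter> fixator t" and ?N = "T - fixator t"
  obtain t' where t': "t' \<in> W" "t ** t' = mat 1" "t' ** t = mat 1"
    using inverse_in[OF T_subset[OF t]] .
  have split: "skew x = (\<Prod>s\<in>?F. herm x (l s)) * (\<Prod>s\<in>?N. herm x (l s))" for x
    unfolding skew_def by (rule prod.Int_Diff) simp
  have F: "(\<Prod>s\<in>?F. herm (t *v x) (l s)) = det t ^ card ?F * (\<Prod>s\<in>?F. herm x (l s))" for x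
  proof -
    have "herm (t *v x) (l s) = det t * herm x (l s)" if s: "s \<in> ?F" for s
    proof -
      obtain a where "l s = a *s l t" using in_fixator_iff[OF t, of s] s by blast
      moreover have "herm (t *v x) (l t) = herm x (l t) + (det t - 1) * herm x (l t)"
        using root_nz[OF t] by (simp add: reflection_eq[OF t] herm_add_left herm_scale_left)
      then have "herm (t *v x) (l t) = det t * herm x (l t)"
        by (simp add: left_diff_distrib)
      ultimately show ?thesis by (simp add: herm_scale_right)
    qed
    then show ?thesis by (simp add: prod.distrib)
  qed
  define c where "c s = t' ** s ** t" for s
  have "\<exists>k. t' *v l s = k *s l (c s)" if "s \<in> T" for s
    using conj_reflection(2)[of s t' t] that t' T_subset[OF t] by (simp add: c_def)
  then obtain k where k: "\<And>s. s \<in> T \<Longrightarrow> t' *v l s = k s *s l (c s)" by metis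
  have c_fix: "c s \<in> fixator t \<longleftrightarrow> s \<in> fixator t" for s
  proof -
    have t'f: "t' \<in> fixator t" using inverse_in_fixator reflection_in_fixator t t' by blast
    have "s = t ** c s ** t'"
      by (metis c_def matrix_mul_assoc matrix_mul_lid matrix_mul_rid t'(2))
    then show ?thesis
      using mult_in_fixator t'f reflection_in_fixator[OF t] unfolding c_def by metis
  qed
  have c_T: "c s \<in> T" if "s \<in> T" for s
    using conj_reflection(1)[of s t' t] that t' T_subset[OF t] by (simp add: c_def)
  have "inj_on c ?N"
    by (rule inj_on_inverseI[of _ "\<lambda>s. t ** s ** t'"])
       (metis c_def matrix_mul_assoc matrix_mul_lid matrix_mul_rid t'(2))
  moreover have "c ` ?N \<subseteq> ?N" using c_fix c_T by auto
  ultimately have bij: "bij_betw c ?N ?N"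
    unfolding bij_betw_def by (simp add: endo_inj_surj)
  define \<kappa> where "\<kappa> = (\<Prod>s\<in>?N. cnj (k s))"
  have N: "(\<Prod>s\<in>?N. herm (t *v x) (l s)) = \<kappa> * (\<Prod>s\<in>?N. herm x (l s))" for x
  proof -
    have "herm (t *v x) (l s) = cnj (k s) * herm x (l (c s))" if "s \<in> ?N" for s
    proof -
      have "herm (t *v x) (l s) = herm (t' *v (t *v x)) (t' *v l s)"
        using herm_invariant t' by simp
      also have "\<dots> = cnj (k s) * herm x (l (c s))"
        using that by (simp add: k herm_simps matrix_vector_mul_assoc t')
      finally show ?thesis .
    qed
    then have "(\<Prod>s\<in>?N. herm (t *v x) (l s)) = \<kappa> * (\<Prod>s\<in>?N. herm x (l (c s)))"
      by (simp add: \<kappa>_def prod.distrib)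
    also have "(\<Prod>s\<in>?N. herm x (l (c s))) = (\<Prod>s\<in>?N. herm x (l s))"
      by (rule prod.reindex_bij_betw[OF bij])
    finally show ?thesis .
  qed
  \<comment> \<open>a point on the reflecting hyperplane of \<open>t\<close> and on no other\<close>
  have "\<exists>x\<in>{x. herm x (l t) = 0}. \<forall>s\<in>?N. herm x (l s) \<noteq> 0"
  proof (rule common_nonroot_on_subspace)
    show "vec.subspace {x. herm x (l t) = 0}"
      using hyperplane_reflection[OF t] by (simp add: hyperplane_def)
    show "\<exists>x\<in>{x. herm x (l t) = 0}. herm x (l s) \<noteq> 0" if "s \<in> ?N" for s
      using non_parallel_roots[OF t, of s] in_fixator_iff[OF t, of s] that by auto
  qed (simp_all add: herm_simps)
  then obtain x0 where x0: "herm x0 (l t) = 0" "\<And>s. s \<in> ?N \<Longrightarrow> herm x0 (l s) \<noteq> 0" by blast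
  have "t *v x0 = x0" using x0(1) by (simp add: reflection_eq[OF t])
  then have "(\<Prod>s\<in>?N. herm x0 (l s)) = \<kappa> * (\<Prod>s\<in>?N. herm x0 (l s))"
    using N[of x0] by simp
  moreover have "(\<Prod>s\<in>?N. herm x0 (l s)) \<noteq> 0" using x0(2) by simp
  ultimately have "\<kappa> = 1" by simp
  have "det t * skew (t *v x) = det t ^ Suc (card ?F) * skew x"
    by (simp add: split[of x] split[of "t *v x"] F N \<open>\<kappa> = 1\<close> mult_ac)
  also have "\<dots> = skew x"
    using det_power_card_fixator[OF t] by (simp only: card_fixator[OF t] mult_1)
  finally show ?thesis .
qed

lemma skew_semi_invariant:
  assumes gen: "generate GL T = W" and s: "s \<in> W"
  shows "det s * skew (s *v x) = skew x"
proof -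
  interpret GL: group "GL :: (complex^'n^'n) monoid" by (rule group_GL)
  from s have "s \<in> generate GL T" using gen by simp
  then show ?thesis
  proof (induction arbitrary: x)
    case one
    then show ?case by (simp add: GL_def)
  next
    case (incl t)
    then show ?case by (rule skew_reflection)
  next
    case (inv t)
    let ?t' = "inv\<^bsub>GL\<^esub> t"
    have "t \<in> carrier GL" using T_subset[OF inv] subgroup.subset[OF subgroup] by auto
    then have t': "t ** ?t' = mat 1" using GL.r_inv[of t] by (simp add: GL_def)
    then have "det t * det ?t' = 1" by (metis det_mul det_I)
    moreover have "det t * skew x = skew (?t' *v x)"
      using skew_reflection[OF inv, of "?t' *v x"] t' by (simp add: matrix_vector_mul_assoc)
    ultimately show ?case by (metis mult.assoc mult.commute mult_1)
  next
    case (eng a b)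
    have "det (a ** b) * skew ((a ** b) *v x) = det b * (det a * skew (a *v (b *v x)))"
      by (simp add: det_mul matrix_vector_mul_assoc)
    then show ?case using eng.IH by (simp add: GL_def)
  qed
qed

section \<open>Skew power sums are multiples of the product of the roots\<close>

text \<open>The sum over \<open>W\<close> is an average of sums over cosets of the fixator of \<open>t\<close>. Splitting \<open>s *v L\<close> into its
  components orthogonal and parallel to \<open>l t\<close>, an element \<open>h\<close> of the fixator multiplies the
  second one by \<open>det h\<close>, and \<open>dvd_twisted_power_sum\<close> applies. The polynomials in one variable
  are restrictions to the line of all \<open>x + z *s y\<close>.\<close>
lemma fixator_power_dvd:
  fixes x y L :: "complex^'n" and N :: nat
  assumes t: "t \<in> T"
  defines "P \<equiv> (\<Sum>s\<in>W. smult (det s) ([:dot (s *v L) x, dot (s *v L) y:] ^ N))"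
  shows "[:dot (l t) x, dot (l t) y:] ^ card (T \<inter> fixator t) dvd P"
proof -
  let ?q = "[:dot (l t) x, dot (l t) y:]"
  define lin where "lin v = [:dot v x, dot v y:]" for v
  have lin_add: "lin (u + c *s v) = lin u + smult c (lin v)" for u v c
    by (simp add: lin_def dot_add_left dot_scale_left)
  define b where "b s = herm (s *v L) (l t) / herm (l t) (l t)" for s
  define u where "u s = s *v L - b s *s l t" for s
  have hs: "lin ((h ** s) *v L) = lin (u s) + smult (det h) (smult (b s) ?q)"
    if h: "h \<in> fixator t" for h s
  proof -
    have "(h ** s) *v L = h *v (s *v L)" by (simp add: matrix_vector_mul_assoc)
    also have "\<dots> = s *v L + ((det h - 1) * b s) *s l t"
      unfolding b_def by (rule fixator_eq[OF t h])
    also have "\<dots> = u s + (det h * b s) *s l t"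
      by (simp add: u_def vec_eq_iff algebra_simps)
    finally show ?thesis by (simp add: lin_add) (simp add: lin_def)
  qed
  have twist: "P = (\<Sum>s\<in>W. smult (det s) (smult (det h) ((lin (u s) + smult (det h) (smult (b s) ?q)) ^ N)))"
    if h: "h \<in> fixator t" for h
  proof -
    have "P = (\<Sum>s\<in>W. smult (det (h ** s)) (lin ((h ** s) *v L) ^ N))"
      unfolding P_def lin_def
      by (rule sum.reindex_bij_betw[OF bij_mult_left[OF fixator_subset[OF h]], symmetric])
    then show ?thesis by (simp add: hs[OF h] det_mul mult.commute)
  qed
  let ?Z = "det ` fixator t"
  have smult_eq: "smult a p = [:a:] * p" for a and p :: "complex poly" by simp
  have "smult (of_nat (card (fixator t))) P = (\<Sum>h\<in>fixator t. P)"
    by (simp add: of_nat_poly)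
  also have "\<dots> = (\<Sum>h\<in>fixator t. \<Sum>s\<in>W. smult (det s)
      (smult (det h) ((lin (u s) + smult (det h) (smult (b s) ?q)) ^ N)))"
    by (rule sum.cong[OF refl twist])
  also have "\<dots> = (\<Sum>s\<in>W. \<Sum>h\<in>fixator t. [:det s:] *
      (smult (det h) ((lin (u s) + smult (det h) (smult (b s) ?q)) ^ N)))"
    by (subst sum.swap) (simp only: smult_eq)
  also have "\<dots> = (\<Sum>s\<in>W. [:det s:] *
      (\<Sum>z\<in>?Z. smult z ((lin (u s) + smult z (smult (b s) ?q)) ^ N)))"
    by (simp only: sum_distrib_left[symmetric] sum.reindex[OF inj_det_fixator[OF t]] o_def)
  also have "?q ^ (card ?Z - 1) dvd \<dots>"
  proof (rule dvd_sum)
    fix s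
    have "?q ^ (card ?Z - 1) dvd smult (b s) ?q ^ (card ?Z - 1)"
      by (intro dvd_power_same dvd_smult dvd_refl)
    also have "\<dots> dvd (\<Sum>z\<in>?Z. smult z ((lin (u s) + smult z (smult (b s) ?q)) ^ N))"
    proof (rule dvd_twisted_power_sum)
      show "0 \<notin> ?Z" using det_nz fixator_subset by (auto simp: image_iff)
      show "a * c \<in> ?Z" if "a \<in> ?Z" "c \<in> ?Z" for a c
        using that mult_in_fixator by (auto simp: det_mul[symmetric])
    qed simp
    finally show "?q ^ (card ?Z - 1) dvd
        [:det s:] * (\<Sum>z\<in>?Z. smult z ((lin (u s) + smult z (smult (b s) ?q)) ^ N))"
      by (rule dvd_mult)
  qed
  finally have "?q ^ (card ?Z - 1) dvd smult (of_nat (card (fixator t))) P" .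
  moreover have "card ?Z - 1 = card (T \<inter> fixator t)"
    using card_fixator[OF t] by (simp add: card_image inj_det_fixator[OF t])
  moreover have "card (fixator t) \<noteq> 0" using card_fixator[OF t] by simp
  ultimately show ?thesis by (simp add: dvd_smult_iff)
qed

text \<open>The value at \<open>z\<close> of the polynomial \<open>\<Sum>s. (det s) (s L) ^ N\<close> in the symmetric algebra.\<close>
definition skew_power_sum :: "complex^'n \<Rightarrow> nat \<Rightarrow> complex^'n \<Rightarrow> complex" where
  "skew_power_sum L N z = (\<Sum>s\<in>W. det s * dot (s *v L) z ^ N)"

text \<open>On the line of all \<open>x + z *s y\<close> the product of the roots has degree exactly \<open>card T\<close>, by the
  first assumption, and non-parallel roots have distinct zeros, by the second. So it divides the
  skew power sum, whose degree is at most \<open>card T\<close>, with a constant quotient \<open>r\<close>. The values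
  at \<open>x\<close> and \<open>y\<close> are the constant and the top coefficients on this line.\<close>
lemma skew_power_sum_proportional:
  assumes y: "\<And>t. t \<in> T \<Longrightarrow> dot (l t) y \<noteq> 0"
    and x: "\<And>s t. s \<in> T \<Longrightarrow> t \<in> T \<Longrightarrow> \<nexists>a. l s = a *s l t \<Longrightarrow>
      dot (l s) x * dot (l t) y \<noteq> dot (l t) x * dot (l s) y"
  shows "skew_power_sum L (card T) x * (\<Prod>t\<in>T. dot (l t) y) = skew_power_sum L (card T) y * (\<Prod>t\<in>T. dot (l t) x)"
proof -
  let ?N = "card T"
  let ?P = "\<Sum>s\<in>W. smult (det s) ([:dot (s *v L) x, dot (s *v L) y:] ^ ?N)"
  let ?Q = "\<Prod>t\<in>T. [:dot (l t) x, dot (l t) y:]"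
  have "?Q dvd ?P"
  proof (rule prod_linear_dvd)
    fix t assume t: "t \<in> T"
    have "{s \<in> T. dot (l s) x * dot (l t) y = dot (l t) x * dot (l s) y} = T \<inter> fixator t"
    proof -
      have "dot (l s) x * dot (l t) y = dot (l t) x * dot (l s) y" if "l s = a *s l t" for s a
        using that by (simp add: dot_scale_left)
      then show ?thesis using x[OF _ t] in_fixator_iff[OF t] by blast
    qed
    then show "[:dot (l t) x, dot (l t) y:] ^
        card {s \<in> T. dot (l s) x * dot (l t) y = dot (l t) x * dot (l s) y} dvd ?P"
      using fixator_power_dvd[OF t] by simp
  qed (use y in auto)
  then obtain R where R: "?P = ?Q * R" by (rule dvdE)
  have "degree ?P \<le> ?N"
    by (rule degree_sum_le) (auto intro: order.trans[OF degree_smult_le] coeff_linear_power)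
  have Q: "degree ?Q \<le> ?N" "coeff ?Q ?N = (\<Prod>t\<in>T. dot (l t) y)" "(\<Prod>t\<in>T. dot (l t) y) \<noteq> 0"
    using coeff_prod_linear[of "\<lambda>t. dot (l t) x" "\<lambda>t. dot (l t) y" T] y by auto
  then have "degree ?Q = ?N" "?Q \<noteq> 0" using le_degree[of ?Q ?N] by auto
  have "degree R = 0"
  proof (cases "R = 0")
    case False
    then have "degree ?P = ?N + degree R"
      using R degree_mult_eq[OF \<open>?Q \<noteq> 0\<close> False] \<open>degree ?Q = ?N\<close> by simp
    with \<open>degree ?P \<le> ?N\<close> show ?thesis by simp
  qed simp
  then obtain r where "R = [:r:]" by (rule degree_eq_zeroE)
  then have P: "?P = smult r ?Q" using R by simp
  have "skew_power_sum L ?N y = coeff ?P ?N"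
    by (simp add: skew_power_sum_def coeff_sum coeff_linear_power)
  also have "\<dots> = r * (\<Prod>t\<in>T. dot (l t) y)" by (simp only: P coeff_smult Q)
  finally have ey: "skew_power_sum L ?N y = r * (\<Prod>t\<in>T. dot (l t) y)" .
  have "skew_power_sum L ?N x = poly ?P 0"
    by (simp add: skew_power_sum_def poly_sum)
  also have "\<dots> = r * (\<Prod>t\<in>T. dot (l t) x)" by (simp only: P) (simp add: poly_prod)
  finally show ?thesis using ey by simp
qed

text \<open>Otherwise polarization at the duals of the roots would give
  \<open>\<Sum>s. det s * skew (s L) = 0\<close>, a sum all of whose terms equal \<open>skew L\<close>.\<close>
lemma skew_power_sum_nonzero:
  assumes gen: "generate GL T = W" and L: "\<And>t. t \<in> T \<Longrightarrow> herm L (l t) \<noteq> 0"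
  shows "\<exists>x. skew_power_sum L (card T) x \<noteq> 0"
proof (rule ccontr)
  assume "\<nexists>x. skew_power_sum L (card T) x \<noteq> 0"
  then have zero: "(\<Sum>s\<in>W. det s * dot (s *v L) x ^ card T) = 0" for x
    by (simp add: skew_power_sum_def)
  have "0 = (\<Sum>s\<in>W. det s * dot (s *v L) 0 ^ (card T - card T) * (\<Prod>t\<in>T. dot (s *v L) (dual (l t))))"
    by (rule polarization[OF _ _ zero, symmetric]) simp_all
  also have "\<dots> = (\<Sum>s\<in>W. det s * skew (s *v L))"
    by (simp add: skew_def herm_eq_dot)
  also have "\<dots> = of_nat (card W) * skew L"
    by (simp add: skew_semi_invariant[OF gen])
  finally have "skew L = 0" using one_in by auto
  then show False using L by (simp add: skew_def)
qed

lemma exists_nonroot: "\<exists>y. \<forall>t\<in>T. dot (l t) y \<noteq> 0"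
proof -
  have "\<exists>y\<in>UNIV. \<forall>t\<in>T. dot (l t) y \<noteq> 0"
  proof (rule common_nonroot_on_subspace)
    show "\<exists>y\<in>UNIV. dot (l t) y \<noteq> 0" if "t \<in> T" for t
      using root_nz[OF that] herm_eq_dot[of "l t" "l t"] by auto
  qed (simp_all add: dot_add_scale_right)
  then show ?thesis by blast
qed

text \<open>With \<open>y\<close> off all kernels of the roots fixed, the proportionality holds for all \<open>x\<close> off
  the kernels of finitely many nonzero linear forms \<open>u\<close>, hence as an identity of polynomials.\<close>
lemma prod_roots_eq_skew_power_sum:
  assumes gen: "generate GL T = W" and L: "\<And>t. t \<in> T \<Longrightarrow> herm L (l t) \<noteq> 0"
  shows "\<exists>C. C \<noteq> 0 \<and> (\<Prod>t\<in>T. linear_form (l t)) =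
     scalar C * (\<Sum>s\<in>W. scalar (det s) * linear_form (s *v L) ^ card T)"
proof -
  define p where "p = (\<Sum>s\<in>W. scalar (det s) * linear_form (s *v L) ^ card T)"
  define f where "f = (\<Prod>t\<in>T. linear_form (l t))"
  have ev_p: "evaluate x p = skew_power_sum L (card T) x" for x
    by (simp add: p_def evaluate_simps skew_power_sum_def)
  have ev_f: "evaluate x f = (\<Prod>t\<in>T. dot (l t) x)" for x
    by (simp add: f_def evaluate_simps)
  obtain y where y: "\<And>t. t \<in> T \<Longrightarrow> dot (l t) y \<noteq> 0" using exists_nonroot by blast
  let ?A = "{(s, t). s \<in> T \<and> t \<in> T \<and> (\<nexists>a. l s = a *s l t)}"
  define u where "u = (\<lambda>(s, t). dot (l t) y *s l s - dot (l s) y *s l t)"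
  define a where "a = evaluate y p"
  define b where "b = evaluate y f"
  have u: "dot (u (s, t)) x = dot (l s) x * dot (l t) y - dot (l t) x * dot (l s) y" for s t x
    by (simp add: u_def dot_diff_left dot_scale_left mult.commute)
  have "scalar b * p + scalar (- a) * f = 0"
  proof (rule evaluate_generic_eq_0)
    show "finite ?A" by (rule finite_subset[of _ "T \<times> T"]) auto
    show "u r \<noteq> 0" if r: "r \<in> ?A" for r
    proof
      assume u0: "u r = 0"
      obtain s t where st: "r = (s, t)" "t \<in> T" and np: "\<nexists>a. l s = a *s l t"
        using r by auto
      have "dot (l t) y *s l s = dot (l s) y *s l t"
        using u0 by (simp add: u_def st(1))
      then have "(inverse (dot (l t) y) * dot (l t) y) *s l s = (inverse (dot (l t) y) * dot (l s) y) *s l t"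
        by (simp only: vector_smult_assoc[symmetric])
      then have "l s = (inverse (dot (l t) y) * dot (l s) y) *s l t"
        using y[OF st(2)] by simp
      with np show False by blast
    qed
    fix x assume gx: "\<And>r. r \<in> ?A \<Longrightarrow> dot (u r) x \<noteq> 0"
    have "skew_power_sum L (card T) x * (\<Prod>t\<in>T. dot (l t) y) = skew_power_sum L (card T) y * (\<Prod>t\<in>T. dot (l t) x)"
    proof (rule skew_power_sum_proportional[OF y])
      fix s t assume "s \<in> T" "t \<in> T" "\<nexists>a. l s = a *s l t"
      then have "dot (u (s, t)) x \<noteq> 0" by (intro gx) simp
      then show "dot (l s) x * dot (l t) y \<noteq> dot (l t) x * dot (l s) y"
        unfolding u by simp
    qed
    then show "evaluate x (scalar b * p + scalar (- a) * f) = 0"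
      by (simp add: evaluate_add evaluate_mult ev_p ev_f a_def b_def mult.commute)
  qed
  moreover have "scalar (- a) = - (scalar a :: 'n sym_alg)" by (simp add: scalar_def single_uminus)
  ultimately have eq: "scalar b * p = scalar a * f" by simp
  have "b \<noteq> 0" using y by (simp add: b_def ev_f)
  have inv: "scalar (inverse c) * (scalar c * q) = q" if "c \<noteq> 0" for c and q :: "'n sym_alg"
    using that by (simp add: mult.assoc[symmetric] scalar_mult)
  have "a \<noteq> 0"
  proof
    assume "a = 0"
    then have "scalar b * p = 0" using eq by (simp add: scalar_def)
    then have "p = 0" using inv[OF \<open>b \<noteq> 0\<close>, of p] by simp
    then show False using skew_power_sum_nonzero[OF gen L] ev_p by simp
  qed
  have "f = scalar (inverse a) * (scalar b * p)"
    unfolding eq using inv[OF \<open>a \<noteq> 0\<close>] by simp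
  then have "f = scalar (inverse a * b) * p"
    by (simp add: mult.assoc flip: scalar_mult)
  moreover have "inverse a * b \<noteq> 0" using \<open>a \<noteq> 0\<close> \<open>b \<noteq> 0\<close> by simp
  ultimately show ?thesis unfolding p_def f_def by blast
qed

end

section \<open>Sums over cosets and the theorem\<close>

lemma (in group) sum_lcosets:
  fixes g :: "'a \<Rightarrow> 'c::comm_semiring_1"
  assumes "subgroup H G" "finite (carrier G)"
    and inv: "\<And>a h. a \<in> carrier G \<Longrightarrow> h \<in> H \<Longrightarrow> g (a \<otimes> h) = g a"
    and rep: "\<And>K. K \<in> lcosets H \<Longrightarrow> rep K \<in> K"
  shows "(\<Sum>a\<in>carrier G. g a) = of_nat (card H) * (\<Sum>K\<in>lcosets H. g (rep K))"
proof -
  have sub: "H \<subseteq> carrier G" using assms(1) by (rule subgroup.subset)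
  have part: "\<Union>(lcosets H) = carrier G" by (rule lcosets_part_G) fact
  have fin: "finite K" if "K \<in> lcosets H" for K
    using that part assms(2) by (metis Sup_upper finite_subset)
  have const: "g a = g (rep K)" if K: "K \<in> lcosets H" and "a \<in> K" for a K
  proof -
    obtain b where b: "b \<in> carrier G" "K = b <# H" using K by (auto simp: LCOSETS_def)
    have "g a = g b" if "a \<in> K" for a
      using that b inv by (auto simp: l_coset_def)
    then show ?thesis using that rep by metis
  qed
  have "(\<Sum>a\<in>\<Union>(lcosets H). g a) = (\<Sum>K\<in>lcosets H. \<Sum>a\<in>K. g a)"
    using fin lcos_disjoint[OF assms(1)] by (subst sum.Union_disjoint) auto
  also have "\<dots> = (\<Sum>K\<in>lcosets H. of_nat (card H) * g (rep K))"
  proof (rule sum.cong[OF refl])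
    fix K assume K: "K \<in> lcosets H"
    have "(\<Sum>a\<in>K. g a) = (\<Sum>a\<in>K. g (rep K))" by (rule sum.cong[OF refl const[OF K]])
    then show "(\<Sum>a\<in>K. g a) = of_nat (card H) * g (rep K)"
      using l_card_cosets_equal[OF K sub assms(2)] by simp
  qed
  finally show ?thesis unfolding part by (simp add: sum_distrib_left)
qed

theorem mainTheorem3:
  fixes W :: "(complex^'n^'n) set"
    and f :: "'n sym_alg"
    and d :: nat
    and w :: "complex^'n^'n"
    and L :: "complex^'n"
    and rep :: "(complex^'n^'n) set \<Rightarrow> complex^'n^'n"
  assumes "complex_reflection_group W"
    and "fundamental_skew_invariant W f"
    and "d > 0"
    and "w \<in> W"
    and "regular_vector W L"
    and "eigenvector w (exp (2 * of_real pi * \<i> / of_nat d)) L"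
    and "\<forall>K \<in> lcosets\<^bsub>GL\<lparr>carrier := W\<rparr>\<^esub> (generate GL {w}). rep K \<in> K"
  shows "\<exists>C. C \<noteq> 0 \<and>
    f = scalar C *
      (\<Sum>K \<in> lcosets\<^bsub>GL\<lparr>carrier := W\<rparr>\<^esub> (generate GL {w}).
         scalar (det (rep K)) * linear_form (rep K *v L) ^ total_degree f)"
proof -
  interpret GL: group "GL :: (complex^'n^'n) monoid" by (rule group_GL)
  have W: "subgroup W GL" "finite W" and gen: "generate GL (pseudo_reflections W) = W"
    using assms(1) by (auto simp: complex_reflection_group_def)
  obtain l where l: "\<forall>t\<in>pseudo_reflections W. \<exists>c. c \<noteq> 1 \<and> eigenvector t c (l t)"
    and f: "f = (\<Prod>t\<in>pseudo_reflections W. linear_form (l t))"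
    using assms(2) by (auto simp: fundamental_skew_invariant_def)
  interpret reflections W l
    by (intro reflections.intro matrix_group.intro reflections_axioms.intro) (use W l in auto)
  let ?D = "card T"
  obtain y where y: "\<forall>t\<in>T. dot (l t) y \<noteq> 0" using exists_nonroot by blast
  have "evaluate y f \<noteq> 0" using y by (simp add: f evaluate_simps)
  then have "f \<noteq> 0" by auto
  then have D: "total_degree f = ?D"
    using homogeneous_prod_linear_forms unfolding f by (rule total_degree_homogeneous[rotated])
  have L: "herm L (l t) \<noteq> 0" if t: "t \<in> T" for t
  proof -
    have "fixes_hyperplane t {x. herm x (l t) = 0}"
      using hyperplane_reflection[OF t] by (simp add: fixes_hyperplane_def reflection_eq[OF t])
    then show ?thesis using assms(5) t by (auto simp: regular_vector_def)
  qed
  obtain \<zeta> where w: "w *v L = \<zeta> *s L" using assms(6) by (auto simp: eigenvector_def)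
  \<comment> \<open>well-definedness on cosets: compare the two ways in which \<open>w\<close> scales \<open>skew L\<close>\<close>
  have "skew (w *v L) = \<zeta> ^ ?D * skew L"
    by (simp add: w skew_def herm_simps prod.distrib)
  then have "(det w * \<zeta> ^ ?D) * skew L = skew L"
    using skew_semi_invariant[OF gen assms(4), of L] by simp
  moreover have "skew L \<noteq> 0" using L by (simp add: skew_def)
  ultimately have det_w: "det w * \<zeta> ^ ?D = 1" by simp
  define g where "g s = scalar (det s) * linear_form (s *v L) ^ ?D" for s
  have g_w: "g (s ** w) = g s" for s
  proof -
    have "(s ** w) *v L = \<zeta> *s (s *v L)"
      by (simp add: w vector_scalar_commute flip: matrix_vector_mul_assoc)
    then have "g (s ** w) = scalar (det s * (det w * \<zeta> ^ ?D)) * linear_form (s *v L) ^ ?D"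
      by (simp add: g_def det_mul linear_form_scale power_mult_distrib scalar_power
          mult.assoc flip: scalar_mult)
    then show ?thesis by (simp add: det_w g_def)
  qed
  have w_GL: "w \<in> carrier GL" using assms(4) subgroup.subset[OF W(1)] by auto
  have g_inv: "g (s ** h) = g s" if "h \<in> generate GL {w}" for h s
    using that
  proof (induction arbitrary: s)
    case (inv h)
    then have "inv\<^bsub>GL\<^esub> h ** w = mat 1" using GL.l_inv[OF w_GL] by (simp add: GL_def)
    then show ?case using g_w[of "s ** inv\<^bsub>GL\<^esub> h"] by (simp flip: matrix_mul_assoc)
  next
    case (eng h1 h2)
    then show ?case by (simp add: GL_def matrix_mul_assoc)
  qed (use g_w in \<open>simp_all add: GL_def\<close>)
  let ?G = "GL\<lparr>carrier := W\<rparr>" and ?H = "generate GL {w}"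
  let ?S = "\<Sum>K\<in>lcosets\<^bsub>?G\<^esub> ?H. g (rep K)"
  interpret G: group ?G using GL.subgroup_imp_group[OF W(1)] .
  have H: "subgroup ?H ?G"
    using GL.generate_is_subgroup[of "{w}"] GL.generate_subgroup_incl[OF _ W(1), of "{w}"] w_GL assms(4)
    by (intro GL.subgroup_incl W) auto
  have sum_W: "(\<Sum>s\<in>W. g s) = of_nat (card ?H) * ?S"
    using G.sum_lcosets[OF H, of g rep] W(2) g_inv assms(7) by (simp add: GL_def)
  have "?H \<subseteq> W" using subgroup.subset[OF H] by simp
  then have "finite ?H" using W(2) by (rule finite_subset)
  then have card_H: "card ?H \<noteq> 0" using subgroup.one_closed[OF H] by auto
  obtain C where C: "C \<noteq> 0" "f = scalar C * (\<Sum>s\<in>W. g s)"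
    using prod_roots_eq_skew_power_sum[OF gen L] unfolding f g_def by blast
  have "of_nat (card ?H) = (scalar (of_nat (card ?H)) :: 'n sym_alg)"
    by (simp add: scalar_def)
  then have "f = scalar (C * of_nat (card ?H)) * ?S"
    using C(2) sum_W by (simp only: mult.assoc scalar_mult[symmetric])
  moreover have "C * of_nat (card ?H) \<noteq> 0" using C(1) card_H by simp
  ultimately show ?thesis unfolding g_def D by blast
qed

end
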